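(* Let $(S,* )$ be a finite multisemigroup. Then its radical $R(S)$ is the maximal (with respect to inclusion) nilpotent two-sided ideal of $S$.
   Context: A multisemigroup is a pair $(S,* )$ with $S$ a non-empty set and $*:S\times S\to 2^S$ a map such that $(a*b)*c=a*(b*c)$ for all $a,b,c\in S$, where for $A,B\subset S$ one puts $A*B:=\bigcup_{a\in A,b\in B}a*b$ and an element is identified with the corresponding singleton. An identity is an element $1$ with $1*a=a*1=\{a\}$ for all $a$; $S^1$ denotes $S$ if $S$ has an identity, and otherwise $S\cup\{1\}$ with a new element $1$ acting as the identity. A two-sided ideal is a (possibly empty) subset $I\subset S$ with $a*s\subset I$ and $s*a\subset I$ for all $a\in I$, $s\in S$. A subset $X\subset S$ is nilpotent if $X^k=\varnothing$ for some $k\in\mathbb{N}$, where $X^k$ is the union of all products $x_1*\dots*x_k$ with $x_i\in X$ (in particular the empty set is nilpotent). The radical of $S$ is $R(S):=\{s\in S\mid S^1*s*S^1\text{ is nilpotent}\}$; it is a two-sided ideal (possibly empty). *)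

theory Defs
  imports Main
begin

definition set_mult :: "('a \<Rightarrow> 'a \<Rightarrow> 'a set) \<Rightarrow> 'a set \<Rightarrow> 'a set \<Rightarrow> 'a set" where
  "set_mult m A B = (\<Union>a\<in>A. \<Union>b\<in>B. m a b)"

locale multisemigroup =
  fixes S :: "'a set" and m :: "'a \<Rightarrow> 'a \<Rightarrow> 'a set"
  assumes nonempty: "S \<noteq> {}"
    and closed: "a \<in> S \<Longrightarrow> b \<in> S \<Longrightarrow> m a b \<subseteq> S"
    and assoc: "a \<in> S \<Longrightarrow> b \<in> S \<Longrightarrow> c \<in> S \<Longrightarrow>
      set_mult m (m a b) {c} = set_mult m {a} (m b c)"

definition is_identity :: "'a set \<Rightarrow> ('a \<Rightarrow> 'a \<Rightarrow> 'a set) \<Rightarrow> 'a \<Rightarrow> bool" where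
  "is_identity S m e \<longleftrightarrow> e \<in> S \<and> (\<forall>a\<in>S. m e a = {a} \<and> m a e = {a})"

text \<open>
  \<open>S\<^sup>1\<close> is realised inside \<^typ>\<open>'a option\<close>: the elements of \<open>S\<close> are embedded by
  \<^const>\<open>Some\<close>, and \<^const>\<open>None\<close> is the new identity. It belongs to the carrier
  only when \<open>S\<close> has no identity of its own.
\<close>

definition adj_carrier :: "'a set \<Rightarrow> ('a \<Rightarrow> 'a \<Rightarrow> 'a set) \<Rightarrow> 'a option set" where
  "adj_carrier S m =
     (if \<exists>e. is_identity S m e then Some ` S else insert None (Some ` S))"

fun adj_mult :: "('a \<Rightarrow> 'a \<Rightarrow> 'a set) \<Rightarrow> 'a option \<Rightarrow> 'a option \<Rightarrow> 'a option set" where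
  "adj_mult m (Some a) (Some b) = Some ` m a b"
| "adj_mult m None y = {y}"
| "adj_mult m x None = {x}"

lemma adj_carrier_cases:
  assumes "x \<in> adj_carrier S m"
  obtains "x = None" | a where "x = Some a" "a \<in> S"
  using assms by (cases x) (auto simp: adj_carrier_def split: if_splits)

lemma Some_mem_adj_carrier: "Some a \<in> adj_carrier S m \<longleftrightarrow> a \<in> S"
  by (auto simp: adj_carrier_def)

lemma image_Some_subset_adj_carrier: "Some ` A \<subseteq> adj_carrier S m \<longleftrightarrow> A \<subseteq> S"
  by (auto simp: image_subset_iff Some_mem_adj_carrier)

lemma adj_multisemigroup:
  assumes "multisemigroup S m"
  shows "multisemigroup (adj_carrier S m) (adj_mult m)"
proof -
  interpret multisemigroup S m by fact
  show ?thesis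
  proof
    show "adj_carrier S m \<noteq> {}"
      using nonempty by (simp add: adj_carrier_def)
  next
    fix a b assume "a \<in> adj_carrier S m" "b \<in> adj_carrier S m"
    then show "adj_mult m a b \<subseteq> adj_carrier S m"
      by (cases a; cases b)
        (simp_all add: image_Some_subset_adj_carrier Some_mem_adj_carrier closed)
  next
    fix a b c
    assume abc: "a \<in> adj_carrier S m" "b \<in> adj_carrier S m" "c \<in> adj_carrier S m"
    show "set_mult (adj_mult m) (adj_mult m a b) {c} = set_mult (adj_mult m) {a} (adj_mult m b c)"
    proof (cases "a = None \<or> b = None \<or> c = None")
      case True
      have "adj_mult m x None = {x}" for x by (cases x) auto
      with True show ?thesis by (auto simp: set_mult_def)
    next
      case False
      then obtain x y z where xyz: "a = Some x" "b = Some y" "c = Some z" by auto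
      have "set_mult (adj_mult m) (adj_mult m a b) {c} = Some ` set_mult m (m x y) {z}"
        by (auto simp: xyz set_mult_def)
      also have "\<dots> = Some ` set_mult m {x} (m y z)"
        using assoc[of x y z] abc by (simp add: xyz Some_mem_adj_carrier)
      also have "\<dots> = set_mult (adj_mult m) {a} (adj_mult m b c)"
        by (auto simp: xyz set_mult_def)
      finally show ?thesis .
    qed
  qed
qed

text \<open>The set \<open>S\<^sup>1 * s * S\<^sup>1\<close>, viewed as a subset of \<open>S\<close>; nothing is lost by
  applying \<open>Some -`\<close>, by \<open>image_principal_ideal\<close> below.\<close>

definition principal_ideal :: "'a set \<Rightarrow> ('a \<Rightarrow> 'a \<Rightarrow> 'a set) \<Rightarrow> 'a \<Rightarrow> 'a set" where
  "principal_ideal S m s = Some -`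
     set_mult (adj_mult m) (set_mult (adj_mult m) (adj_carrier S m) {Some s}) (adj_carrier S m)"

lemma adj_product_subset:
  assumes "multisemigroup S m" "s \<in> S"
  shows "set_mult (adj_mult m) (set_mult (adj_mult m) (adj_carrier S m) {Some s}) (adj_carrier S m)
    \<subseteq> Some ` S"
proof -
  interpret multisemigroup S m by fact
  have left: "adj_mult m x (Some s) \<subseteq> Some ` S" if "x \<in> adj_carrier S m" for x
    using that by (elim adj_carrier_cases) (simp_all add: assms(2) closed image_mono)
  have right: "adj_mult m (Some a) y \<subseteq> Some ` S" if "a \<in> S" "y \<in> adj_carrier S m" for a y
    using that(2) by (elim adj_carrier_cases) (simp_all add: that(1) closed image_mono)
  show ?thesis
  proof (unfold set_mult_def, intro UN_least)
    fix u y assume u: "u \<in> (\<Union>x\<in>adj_carrier S m. \<Union>b\<in>{Some s}. adj_mult m x b)"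
      and y: "y \<in> adj_carrier S m"
    from u left obtain a where "u = Some a" "a \<in> S" by auto
    with y show "adj_mult m u y \<subseteq> Some ` S" by (simp only: right)
  qed
qed

lemma image_principal_ideal:
  assumes "multisemigroup S m" "s \<in> S"
  shows "Some ` principal_ideal S m s =
    set_mult (adj_mult m) (set_mult (adj_mult m) (adj_carrier S m) {Some s}) (adj_carrier S m)"
  using adj_product_subset[OF assms] unfolding principal_ideal_def by blast

definition two_sided_ideal :: "'a set \<Rightarrow> ('a \<Rightarrow> 'a \<Rightarrow> 'a set) \<Rightarrow> 'a set \<Rightarrow> bool" where
  "two_sided_ideal S m I \<longleftrightarrow> I \<subseteq> S \<and> (\<forall>a\<in>I. \<forall>s\<in>S. m a s \<subseteq> I \<and> m s a \<subseteq> I)"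

text \<open>The product \<open>x\<^sub>1 * \<dots> * x\<^sub>k\<close> of a nonempty sequence, given by its head and tail.\<close>

primrec seq_prod :: "('a \<Rightarrow> 'a \<Rightarrow> 'a set) \<Rightarrow> 'a \<Rightarrow> 'a list \<Rightarrow> 'a set" where
  "seq_prod m x [] = {x}"
| "seq_prod m x (y # ys) = set_mult m {x} (seq_prod m y ys)"

text \<open>\<open>X\<^sup>k\<close>, meaningful for \<open>k \<ge> 1\<close> only.\<close>

definition set_pow :: "('a \<Rightarrow> 'a \<Rightarrow> 'a set) \<Rightarrow> 'a set \<Rightarrow> nat \<Rightarrow> 'a set" where
  "set_pow m X k =
     \<Union> {seq_prod m x xs |x xs. length (x # xs) = k \<and> set (x # xs) \<subseteq> X}"

text \<open>The exponent must be positive: with the definition above \<open>X\<^sup>0\<close> would be empty for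
  every \<open>X\<close>.\<close>

definition nilpotent :: "('a \<Rightarrow> 'a \<Rightarrow> 'a set) \<Rightarrow> 'a set \<Rightarrow> bool" where
  "nilpotent m X \<longleftrightarrow> (\<exists>k\<ge>1. set_pow m X k = {})"

definition radical :: "'a set \<Rightarrow> ('a \<Rightarrow> 'a \<Rightarrow> 'a set) \<Rightarrow> 'a set" where
  "radical S m = {s \<in> S. nilpotent m (principal_ideal S m s)}"

end

theory Submission imports Defs begin

text \<open>
  The radical consists of exactly those elements that lie in some nilpotent two-sided ideal:
  \<open>S\<^sup>1 * s * S\<^sup>1\<close> is the smallest two-sided ideal containing \<open>s\<close>, and subsets of nilpotent sets
  are nilpotent (\<open>radical_eq_Union_nilpotent_ideals\<close>). In this form it is clear that the radical
  is an ideal and contains every nilpotent ideal.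

  That the radical is itself nilpotent is where finiteness enters: it is covered by finitely many
  nilpotent ideals, so it suffices that the union of two nilpotent ideals \<open>I\<close> and \<open>J\<close> is
  nilpotent (\<open>nilpotent_Un_ideal\<close>). In a product of \<open>p\<close> factors from \<open>I \<union> J\<close>, either all factors
  lie in \<open>I\<close>, or some factor lies in \<open>J\<close> and the ideal \<open>J\<close> absorbs the whole product. Hence
  \<open>(I \<union> J)\<^sup>p \<subseteq> I\<^sup>p \<union> J\<close>. If \<open>I\<^sup>p\<close> and \<open>J\<^sup>q\<close> are empty, then
  \<open>(I \<union> J)\<^sup>p\<^sup>q = ((I \<union> J)\<^sup>p)\<^sup>q \<subseteq> J\<^sup>q = {}\<close>.
\<close>

section \<open>Powers of subsets\<close>

lemma set_mult_mono: "A \<subseteq> A' \<Longrightarrow> B \<subseteq> B' \<Longrightarrow> set_mult m A B \<subseteq> set_mult m A' B'"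
  unfolding set_mult_def by blast

lemma set_pow_one: "set_pow m X (Suc 0) = X"
  by (auto simp: set_pow_def)

text \<open>Splitting off the first factor makes the laws of exponents accessible to induction. All of
  them are stated for exponents of the form \<open>Suc k\<close>, since \<open>X\<^sup>0 = {}\<close> breaks them at zero.\<close>

lemma set_pow_Suc_Suc: "set_pow m X (Suc (Suc k)) = set_mult m X (set_pow m X (Suc k))"
proof
  show "set_pow m X (Suc (Suc k)) \<subseteq> set_mult m X (set_pow m X (Suc k))"
  proof
    fix z assume "z \<in> set_pow m X (Suc (Suc k))"
    then obtain x xs where x: "length xs = Suc k" "x \<in> X" "set xs \<subseteq> X" "z \<in> seq_prod m x xs"
      by (auto simp: set_pow_def)
    then obtain y ys where xs: "xs = y # ys" by (cases xs) auto
    with x have "seq_prod m y ys \<subseteq> set_pow m X (Suc k)"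
      unfolding set_pow_def by fastforce
    with x xs show "z \<in> set_mult m X (set_pow m X (Suc k))"
      by (auto simp: set_mult_def)
  qed
next
  show "set_mult m X (set_pow m X (Suc k)) \<subseteq> set_pow m X (Suc (Suc k))"
  proof
    fix z assume "z \<in> set_mult m X (set_pow m X (Suc k))"
    then obtain x y ys where x: "x \<in> X" "length ys = k" "set (y # ys) \<subseteq> X"
      and z: "z \<in> set_mult m {x} (seq_prod m y ys)"
      by (auto simp: set_mult_def set_pow_def)
    from z have "z \<in> seq_prod m x (y # ys)" by simp
    moreover have "length (x # y # ys) = Suc (Suc k)" "set (x # y # ys) \<subseteq> X"
      using x by auto
    ultimately show "z \<in> set_pow m X (Suc (Suc k))"
      unfolding set_pow_def by blast
  qed
qed

lemma set_pow_mono: "X \<subseteq> Y \<Longrightarrow> set_pow m X k \<subseteq> set_pow m Y k"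
  unfolding set_pow_def by blast

lemma nilpotent_subset: "nilpotent m Y \<Longrightarrow> X \<subseteq> Y \<Longrightarrow> nilpotent m X"
  unfolding nilpotent_def using set_pow_mono by blast

lemma nilpotent_empty: "nilpotent m {}"
  unfolding nilpotent_def using set_pow_one by (metis One_nat_def order_refl)

lemma nilpotentE:
  assumes "nilpotent m X"
  obtains k where "set_pow m X (Suc k) = {}"
  using assms unfolding nilpotent_def by (metis One_nat_def Suc_le_D)

lemma nilpotentI: "set_pow m X (Suc k) = {} \<Longrightarrow> nilpotent m X"
  unfolding nilpotent_def by (intro exI[of _ "Suc k"]) auto

lemma two_sided_ideal_Un:
  "two_sided_ideal S m I \<Longrightarrow> two_sided_ideal S m J \<Longrightarrow> two_sided_ideal S m (I \<union> J)"
  unfolding two_sided_ideal_def by blast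

context multisemigroup
begin

lemma set_mult_closed: "A \<subseteq> S \<Longrightarrow> B \<subseteq> S \<Longrightarrow> set_mult m A B \<subseteq> S"
  using closed unfolding set_mult_def by blast

lemma set_mult_assoc:
  assumes "A \<subseteq> S" "B \<subseteq> S" "C \<subseteq> S"
  shows "set_mult m (set_mult m A B) C = set_mult m A (set_mult m B C)"
proof -
  have "set_mult m (set_mult m A B) C = (\<Union>a\<in>A. \<Union>b\<in>B. \<Union>c\<in>C. set_mult m (m a b) {c})"
    unfolding set_mult_def by blast
  also have "\<dots> = (\<Union>a\<in>A. \<Union>b\<in>B. \<Union>c\<in>C. set_mult m {a} (m b c))"
    using assms by (intro SUP_cong refl assoc) auto
  also have "\<dots> = set_mult m A (set_mult m B C)"
    unfolding set_mult_def by blast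
  finally show ?thesis .
qed

lemma set_pow_closed: "X \<subseteq> S \<Longrightarrow> set_pow m X (Suc k) \<subseteq> S"
  by (induction k) (simp_all add: set_pow_one set_pow_Suc_Suc set_mult_closed)

lemma set_pow_add:
  assumes "X \<subseteq> S"
  shows "set_pow m X (Suc (i + Suc j)) = set_mult m (set_pow m X (Suc i)) (set_pow m X (Suc j))"
  by (induction i)
    (simp_all add: set_pow_one set_pow_Suc_Suc set_mult_assoc set_pow_closed assms)

lemma set_pow_set_pow:
  assumes "X \<subseteq> S"
  shows "set_pow m (set_pow m X (Suc p)) (Suc q) = set_pow m X (Suc q * Suc p)"
proof (induction q)
  case 0
  show ?case by (simp add: set_pow_one)
next
  case (Suc q)
  have "set_pow m (set_pow m X (Suc p)) (Suc (Suc q)) =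
      set_mult m (set_pow m X (Suc p)) (set_pow m X (Suc (p + q * Suc p)))"
    unfolding set_pow_Suc_Suc[of m "set_pow m X (Suc p)"] Suc by (simp only: mult_Suc add_Suc)
  also have "\<dots> = set_pow m X (Suc (p + Suc (p + q * Suc p)))"
    by (simp only: set_pow_add[OF assms])
  also have "Suc (p + Suc (p + q * Suc p)) = Suc (Suc q) * Suc p"
    by simp
  finally show ?case .
qed

section \<open>Unions of nilpotent ideals\<close>

text \<open>A product with some factor in the ideal \<open>J\<close> is absorbed by \<open>J\<close>, so outside \<open>J\<close> only the
  products with all factors in \<open>I\<close> remain.\<close>

lemma set_pow_Un_ideal_subset:
  assumes "I \<subseteq> S" "two_sided_ideal S m J"
  shows "set_pow m (I \<union> J) (Suc p) \<subseteq> set_pow m I (Suc p) \<union> J"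
proof (induction p)
  case 0
  show ?case by (simp add: set_pow_one)
next
  case (Suc p)
  have J: "J \<subseteq> S" "\<And>a b. a \<in> J \<Longrightarrow> b \<in> S \<Longrightarrow> m a b \<subseteq> J" "\<And>a b. a \<in> J \<Longrightarrow> b \<in> S \<Longrightarrow> m b a \<subseteq> J"
    using assms(2) by (auto simp: two_sided_ideal_def)
  have "set_pow m (I \<union> J) (Suc (Suc p)) \<subseteq> set_mult m (I \<union> J) (set_pow m I (Suc p) \<union> J)"
    unfolding set_pow_Suc_Suc by (intro set_mult_mono Suc order_refl)
  also have "\<dots> \<subseteq> set_mult m I (set_pow m I (Suc p)) \<union> J"
  proof -
    have "m a b \<subseteq> set_mult m I (set_pow m I (Suc p)) \<union> J"
      if a: "a \<in> I \<union> J" and b: "b \<in> set_pow m I (Suc p) \<union> J" for a b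
    proof (cases "a \<in> J \<or> b \<in> J")
      case True
      moreover have "a \<in> S" "b \<in> S"
        using a b assms(1) J(1) set_pow_closed[OF assms(1), of p] by auto
      ultimately show ?thesis using J(2,3) by blast
    next
      case False
      with a b show ?thesis by (auto simp: set_mult_def)
    qed
    then show ?thesis
      unfolding set_mult_def[of m "I \<union> J"] by (intro UN_least)
  qed
  finally show ?case unfolding set_pow_Suc_Suc .
qed

lemma nilpotent_Un_ideal:
  assumes "I \<subseteq> S" "nilpotent m I" "two_sided_ideal S m J" "nilpotent m J"
  shows "nilpotent m (I \<union> J)"
proof -
  obtain p q where p: "set_pow m I (Suc p) = {}" and q: "set_pow m J (Suc q) = {}"
    using assms by (elim nilpotentE)
  have "I \<union> J \<subseteq> S"
    using assms by (auto simp: two_sided_ideal_def)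
  then have "set_pow m (I \<union> J) (Suc q * Suc p) = set_pow m (set_pow m (I \<union> J) (Suc p)) (Suc q)"
    by (simp only: set_pow_set_pow)
  also have "\<dots> \<subseteq> set_pow m J (Suc q)"
    using set_pow_Un_ideal_subset[OF assms(1,3), of p] p by (intro set_pow_mono) simp
  finally have "set_pow m (I \<union> J) (Suc (p + q * Suc p)) = {}"
    unfolding q by (simp only: mult_Suc add_Suc) simp
  then show ?thesis by (rule nilpotentI)
qed

section \<open>The ideal generated by an element\<close>

lemma mem_principal_ideal:
  assumes "s \<in> S"
  shows "s \<in> principal_ideal S m s"
proof -
  \<comment> \<open>The witness is \<open>1 * s * 1\<close>, where the identity of \<open>S\<^sup>1\<close> is either that of \<open>S\<close> or new.\<close>
  obtain u where "u \<in> adj_carrier S m"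
    "adj_mult m u (Some s) = {Some s}" "adj_mult m (Some s) u = {Some s}"
  proof (cases "\<exists>e. is_identity S m e")
    case True
    then obtain e where "is_identity S m e" ..
    with assms show ?thesis
      by (intro that[of "Some e"]) (auto simp: Some_mem_adj_carrier is_identity_def)
  next
    case False
    then show ?thesis
      by (intro that[of None]) (auto simp: adj_carrier_def)
  qed
  then have "Some s \<in> set_mult (adj_mult m)
      (set_mult (adj_mult m) (adj_carrier S m) {Some s}) (adj_carrier S m)"
    unfolding set_mult_def by (intro UN_I[of "Some s"] UN_I[of u]) simp_all
  then show ?thesis
    unfolding principal_ideal_def by simp
qed

text \<open>\<open>S\<^sup>1\<close> is again a multisemigroup, and by associativity a factor from \<open>S\<close> multiplied onto
  \<open>S\<^sup>1 * s * S\<^sup>1\<close> is absorbed by the outer copy of \<open>S\<^sup>1\<close>.\<close>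

lemma principal_ideal_ideal:
  assumes "s \<in> S"
  shows "two_sided_ideal S m (principal_ideal S m s)"
proof -
  have ms: "multisemigroup S m" ..
  interpret adj: multisemigroup "adj_carrier S m" "adj_mult m"
    by (rule adj_multisemigroup[OF ms])
  let ?A = "adj_carrier S m" and ?P = "principal_ideal S m s"
  let ?mul = "set_mult (adj_mult m)"
  note P = image_principal_ideal[OF ms assms]
  have s: "{Some s} \<subseteq> ?A" using assms by (simp add: Some_mem_adj_carrier)
  have "Some ` ?P \<subseteq> Some ` S"
    unfolding P by (rule adj_product_subset[OF ms assms])
  then have sub: "?P \<subseteq> S" by blast
  have "m a t \<subseteq> ?P \<and> m t a \<subseteq> ?P" if a: "a \<in> ?P" and t: "t \<in> S" for a t
  proof -
    have t': "{Some t} \<subseteq> ?A" using t by (simp add: Some_mem_adj_carrier)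
    have "?mul (Some ` ?P) {Some t} = ?mul (?mul ?A {Some s}) (?mul ?A {Some t})"
      unfolding P by (intro adj.set_mult_assoc adj.set_mult_closed s t' order_refl)
    also have "\<dots> \<subseteq> Some ` ?P"
      unfolding P by (intro set_mult_mono order_refl adj.set_mult_closed t')
    finally have right: "?mul (Some ` ?P) {Some t} \<subseteq> Some ` ?P" .
    have "?mul {Some t} (Some ` ?P) = ?mul (?mul (?mul {Some t} ?A) {Some s}) ?A"
      unfolding P
      by (simp only: adj.set_mult_assoc adj.set_mult_closed s t' order_refl)
    also have "\<dots> \<subseteq> Some ` ?P"
      unfolding P by (intro set_mult_mono order_refl adj.set_mult_closed t')
    finally have left: "?mul {Some t} (Some ` ?P) \<subseteq> Some ` ?P" .
    have "Some ` m a t \<subseteq> Some ` ?P"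
      using right a unfolding set_mult_def by auto
    moreover have "Some ` m t a \<subseteq> Some ` ?P"
      using left a unfolding set_mult_def by auto
    ultimately show ?thesis by blast
  qed
  with sub show ?thesis by (simp add: two_sided_ideal_def)
qed

lemma principal_ideal_subset:
  assumes "two_sided_ideal S m I" "s \<in> I"
  shows "principal_ideal S m s \<subseteq> I"
proof -
  have I: "\<And>a b. a \<in> I \<Longrightarrow> b \<in> S \<Longrightarrow> m a b \<subseteq> I \<and> m b a \<subseteq> I"
    using assms(1) by (auto simp: two_sided_ideal_def)
  have left: "adj_mult m x (Some a) \<subseteq> Some ` I" if "x \<in> adj_carrier S m" "a \<in> I" for x a
    using that I by (elim adj_carrier_cases) (simp_all add: image_mono)
  have right: "adj_mult m (Some a) y \<subseteq> Some ` I" if "y \<in> adj_carrier S m" "a \<in> I" for y a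
    using that I by (elim adj_carrier_cases) (simp_all add: image_mono)
  show ?thesis
  proof
    fix z assume "z \<in> principal_ideal S m s"
    then obtain x u y where x: "x \<in> adj_carrier S m" "u \<in> adj_mult m x (Some s)"
      and y: "y \<in> adj_carrier S m" "Some z \<in> adj_mult m u y"
      unfolding principal_ideal_def set_mult_def by auto
    from left[OF x(1) assms(2)] x(2) obtain a where "u = Some a" "a \<in> I" by auto
    with right[OF y(1)] y(2) show "z \<in> I" by auto
  qed
qed

section \<open>The radical\<close>

text \<open>An element of the radical lies in the nilpotent ideal that it generates; conversely, the ideal
  generated by an element of a nilpotent ideal is contained in that ideal, hence nilpotent.\<close>

lemma radical_eq_Union_nilpotent_ideals:
  "radical S m = \<Union> {I. two_sided_ideal S m I \<and> nilpotent m I}"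
proof
  show "radical S m \<subseteq> \<Union> {I. two_sided_ideal S m I \<and> nilpotent m I}"
    unfolding radical_def using mem_principal_ideal principal_ideal_ideal by blast
  show "\<Union> {I. two_sided_ideal S m I \<and> nilpotent m I} \<subseteq> radical S m"
  proof clarify
    fix s I assume I: "two_sided_ideal S m I" "nilpotent m I" and s: "s \<in> I"
    then have "nilpotent m (principal_ideal S m s)"
      using principal_ideal_subset nilpotent_subset by metis
    moreover have "s \<in> S"
      using I(1) s by (auto simp: two_sided_ideal_def)
    ultimately show "s \<in> radical S m"
      by (simp add: radical_def)
  qed
qed

lemma radical_ideal: "two_sided_ideal S m (radical S m)"
  unfolding two_sided_ideal_def
proof (intro conjI ballI)
  show "radical S m \<subseteq> S"
    by (auto simp: radical_def)
next
  fix a s assume "a \<in> radical S m" and s: "s \<in> S"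
  then obtain I where I: "two_sided_ideal S m I" "nilpotent m I" "a \<in> I"
    by (auto simp: radical_eq_Union_nilpotent_ideals)
  then have "I \<subseteq> radical S m"
    by (auto simp: radical_eq_Union_nilpotent_ideals)
  moreover have "m a s \<subseteq> I" "m s a \<subseteq> I"
    using I s by (auto simp: two_sided_ideal_def)
  ultimately show "m a s \<subseteq> radical S m" "m s a \<subseteq> radical S m"
    by auto
qed

text \<open>Without finiteness no single exponent need serve all elements of the radical; for finitely
  many elements, the nilpotent ideals containing them can be united one at a time.\<close>

lemma finite_subset_radical_in_nilpotent_ideal:
  assumes "finite F" "F \<subseteq> radical S m"
  shows "\<exists>I. two_sided_ideal S m I \<and> nilpotent m I \<and> F \<subseteq> I"
  using assms
proof (induction F rule: finite_induct)
  case empty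
  show ?case
    by (intro exI[of _ "{}"]) (simp add: two_sided_ideal_def nilpotent_empty)
next
  case (insert s F)
  then obtain I where I: "two_sided_ideal S m I" "nilpotent m I" "F \<subseteq> I" by auto
  obtain J where J: "two_sided_ideal S m J" "nilpotent m J" "s \<in> J"
    using insert.prems by (auto simp: radical_eq_Union_nilpotent_ideals)
  have "nilpotent m (I \<union> J)"
    using I J by (intro nilpotent_Un_ideal) (auto simp: two_sided_ideal_def)
  with I J show ?case
    by (intro exI[of _ "I \<union> J"]) (auto intro: two_sided_ideal_Un)
qed

end

theorem lemma29:
  fixes S :: "'a set" and m :: "'a \<Rightarrow> 'a \<Rightarrow> 'a set"
  assumes "multisemigroup S m" and "finite S"
  shows "two_sided_ideal S m (radical S m) \<and> nilpotent m (radical S m) \<and>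
    (\<forall>I. two_sided_ideal S m I \<and> nilpotent m I \<longrightarrow> I \<subseteq> radical S m)"
proof -
  interpret multisemigroup S m by fact
  have "finite (radical S m)"
    using assms(2) by (simp add: radical_def)
  then obtain I where "nilpotent m I" "radical S m \<subseteq> I"
    using finite_subset_radical_in_nilpotent_ideal by auto
  then have "nilpotent m (radical S m)"
    by (rule nilpotent_subset)
  moreover have "\<forall>I. two_sided_ideal S m I \<and> nilpotent m I \<longrightarrow> I \<subseteq> radical S m"
    by (auto simp: radical_eq_Union_nilpotent_ideals)
  ultimately show ?thesis
    using radical_ideal by simp
qed

end
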